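(* Let $m$ and $n$ be integers with $m,n\ge 2$. Then the $m\times n$ Klein bottle grid graph $\mathcal{K}_{m,n}$ admits a $C_4$-face-magic Klein bottle labeling if and only if $n$ is even.
   Context: For integers $m,n\ge 2$, the $m\times n$ Klein bottle grid graph $\mathcal{K}_{m,n}$ has vertex set $\{(i,j):1\le i\le m,\ 1\le j\le n\}$ and edges $(i,j)(i,j+1)$ for $1\le i\le m$, $1\le j\le n-1$; $(i,n)(i,1)$ for $1\le i\le m$; $(i,j)(i+1,j)$ for $1\le i\le m-1$, $1\le j\le n$; and $(m,j)(1,n+1-j)$ for $1\le j\le n$. It is embedded in the Klein bottle in the natural way; its faces that are $4$-cycles are, with column indices taken modulo $n$, the vertex sets $\{(i,j),(i,j+1),(i+1,j),(i+1,j+1)\}$ for $1\le i\le m-1$, $1\le j\le n$, and $\{(m,j),(m,j+1),(1,n+1-j),(1,n-j)\}$ for $1\le j\le n$. A $C_4$-face-magic Klein bottle labeling of $\mathcal{K}_{m,n}$ is a bijection $f:V(\mathcal{K}_{m,n})\to\{1,2,\dots,mn\}$ (write $x_{i,j}=f(i,j)$) such that the sum of the labels of the four vertices of every such $4$-cycle face equals one common constant $S$ (the $C_4$-face-magic value). *)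

theory Defs
  imports Main
begin

text \<open>Representative in \<open>{1..n}\<close> of a column index modulo \<open>n\<close>; in particular
  \<open>col n 0 = n\<close> and \<open>col n (n + 1) = 1\<close>.\<close>

definition col :: "nat \<Rightarrow> nat \<Rightarrow> nat" where
  "col n j = (j + n - 1) mod n + 1"

definition klein_vertices :: "nat \<Rightarrow> nat \<Rightarrow> (nat \<times> nat) set" where
  "klein_vertices m n = {1..m} \<times> {1..n}"

definition klein_edges :: "nat \<Rightarrow> nat \<Rightarrow> (nat \<times> nat) set set" where
  "klein_edges m n =
     {{(i, j), (i, j + 1)} | i j. 1 \<le> i \<and> i \<le> m \<and> 1 \<le> j \<and> j \<le> n - 1} \<union>
     {{(i, n), (i, 1)} | i. 1 \<le> i \<and> i \<le> m} \<union>
     {{(i, j), (i + 1, j)} | i j. 1 \<le> i \<and> i \<le> m - 1 \<and> 1 \<le> j \<and> j \<le> n} \<union>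
     {{(m, j), (1, n + 1 - j)} | j. 1 \<le> j \<and> j \<le> n}"

definition klein_grid :: "nat \<Rightarrow> nat \<Rightarrow> (nat \<times> nat) set \<times> (nat \<times> nat) set set" where
  "klein_grid m n = (klein_vertices m n, klein_edges m n)"

text \<open>The \<open>C\<^sub>4\<close>-faces of the natural embedding, given by their vertex sets.\<close>

definition klein_C4_faces :: "nat \<Rightarrow> nat \<Rightarrow> (nat \<times> nat) set set" where
  "klein_C4_faces m n =
     {{(i, j), (i, col n (j + 1)), (i + 1, j), (i + 1, col n (j + 1))} | i j.
        1 \<le> i \<and> i \<le> m - 1 \<and> 1 \<le> j \<and> j \<le> n} \<union>
     {{(m, j), (m, col n (j + 1)), (1, col n (n + 1 - j)), (1, col n (n - j))} | j.
        1 \<le> j \<and> j \<le> n}"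

definition C4_face_magic_klein_labeling :: "nat \<Rightarrow> nat \<Rightarrow> (nat \<times> nat \<Rightarrow> nat) \<Rightarrow> bool" where
  "C4_face_magic_klein_labeling m n f \<longleftrightarrow>
     bij_betw f (fst (klein_grid m n)) {1..m * n} \<and>
     (\<exists>S. \<forall>F \<in> klein_C4_faces m n. (\<Sum>v\<in>F. f v) = S)"

lemma col_Suc: "1 \<le> j \<Longrightarrow> j \<le> n \<Longrightarrow> col n (Suc j) = (if j = n then 1 else j + 1)"
  by (auto simp: col_def)

lemma col_id: "1 \<le> j \<Longrightarrow> j \<le> n \<Longrightarrow> col n j = j"
  by (cases j) (auto simp: col_def)

lemma col_0: "1 \<le> n \<Longrightarrow> col n 0 = n"
  by (auto simp: col_def)

definition is_C4 :: "'a set \<times> 'a set set \<Rightarrow> 'a set \<Rightarrow> bool" where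
  "is_C4 G F \<longleftrightarrow> (\<exists>a b c d. F = {a, b, c, d} \<and> distinct [a, b, c, d] \<and> F \<subseteq> fst G \<and>
     {a, b} \<in> snd G \<and> {b, c} \<in> snd G \<and> {c, d} \<in> snd G \<and> {d, a} \<in> snd G)"

lemma row_edge:
  assumes "1 \<le> i" "i \<le> m" "1 \<le> j" "j \<le> n"
  shows "{(i, j), (i, col n (j + 1))} \<in> klein_edges m n"
proof (cases "j = n")
  case True
  then show ?thesis using assms unfolding klein_edges_def by (auto simp: col_Suc)
next
  case False
  then have "j \<le> n - 1" "col n (j + 1) = j + 1" using assms by (auto simp: col_Suc)
  then show ?thesis using assms unfolding klein_edges_def by auto
qed

lemma col_edge:
  assumes "1 \<le> i" "i \<le> m - 1" "1 \<le> j" "j \<le> n"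
  shows "{(i, j), (i + 1, j)} \<in> klein_edges m n"
  using assms unfolding klein_edges_def by blast

lemma twist_edge:
  assumes "1 \<le> j" "j \<le> n"
  shows "{(m, j), (1, n + 1 - j)} \<in> klein_edges m n"
  using assms unfolding klein_edges_def by blast

lemma col_range: "1 \<le> n \<Longrightarrow> 1 \<le> col n j \<and> col n j \<le> n"
  by (simp add: col_def Suc_leI)

text \<open>Every face in \<open>klein_C4_faces\<close> is a 4-cycle on four distinct vertices, so the sum over the
  vertex set is a sum of four labels.\<close>

lemma klein_C4_faces_are_C4:
  assumes "m \<ge> 2" "n \<ge> 2" "F \<in> klein_C4_faces m n"
  shows "is_C4 (klein_grid m n) F"
proof -
  consider (inner) i j where "1 \<le> i" "i \<le> m - 1" "1 \<le> j" "j \<le> n"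
      "F = {(i, j), (i, col n (j + 1)), (i + 1, j), (i + 1, col n (j + 1))}"
    | (twist) j where "1 \<le> j" "j \<le> n"
      "F = {(m, j), (m, col n (j + 1)), (1, col n (n + 1 - j)), (1, col n (n - j))}"
    using assms(3) unfolding klein_C4_faces_def by blast
  then show ?thesis
  proof cases
    case inner
    define k where "k = col n (j + 1)"
    have k: "1 \<le> k" "k \<le> n" using col_range[of n "j + 1"] assms(2) by (auto simp: k_def)
    have "k \<noteq> j" using inner assms(2) by (auto simp: k_def col_Suc)
    then have d: "distinct [(i, j), (i, k), (i + 1, k), (i + 1, j)]" by auto
    have e1: "{(i, j), (i, k)} \<in> klein_edges m n"
      and e3: "{(i + 1, k), (i + 1, j)} \<in> klein_edges m n"
      using row_edge[of i m j n] row_edge[of "i + 1" m j n] inner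
      by (auto simp: k_def insert_commute)
    have e2: "{(i, k), (i + 1, k)} \<in> klein_edges m n"
      and e4: "{(i + 1, j), (i, j)} \<in> klein_edges m n"
      using col_edge[of i m k n] col_edge[of i m j n] inner k by (auto simp: insert_commute)
    have "F = {(i, j), (i, k), (i + 1, k), (i + 1, j)}" using inner(5) by (auto simp: k_def)
    moreover from this have "F \<subseteq> klein_vertices m n"
      using inner(1-4) k by (auto simp: klein_vertices_def)
    ultimately show ?thesis unfolding is_C4_def klein_grid_def fst_conv snd_conv
      using d e1 e2 e3 e4 by blast
  next
    case twist
    define k where "k = col n (j + 1)"
    define l where "l = n + 1 - j"
    have k: "1 \<le> k" "k \<le> n" using col_range[of n "j + 1"] assms(2) by (auto simp: k_def)
    have l: "1 \<le> l" "l \<le> n" using twist by (auto simp: l_def)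
    have cl: "col n (n + 1 - j) = l" using l col_id by (auto simp: l_def)
    have ck: "col n (n - j) = n + 1 - k"
      using twist assms(2) by (cases "j = n") (auto simp: k_def col_Suc col_0 col_id)
    have "k \<noteq> j" using twist assms(2) by (auto simp: k_def col_Suc)
    then have d: "distinct [(m, j), (m, k), (1, n + 1 - k), (1, l)]"
      using assms(1) k twist by (auto simp: l_def)
    have e1: "{(m, j), (m, k)} \<in> klein_edges m n"
      using row_edge[of m m j n] twist assms(1) by (auto simp: k_def)
    have e2: "{(m, k), (1, n + 1 - k)} \<in> klein_edges m n" using twist_edge k by auto
    have e4: "{(1, l), (m, j)} \<in> klein_edges m n"
      using twist_edge[of j n m] twist by (auto simp: l_def insert_commute)
    have "col n (n + 1 - k + 1) = l"
      using twist assms(2) by (cases "j = n") (auto simp: k_def l_def col_Suc col_id Suc_diff_le)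
    then have e3: "{(1, n + 1 - k), (1, l)} \<in> klein_edges m n"
      using row_edge[of 1 m "n + 1 - k" n] k assms(1) by auto
    have "F = {(m, j), (m, k), (1, n + 1 - k), (1, l)}"
      using twist(3) unfolding cl ck by (auto simp: k_def)
    moreover from this have "F \<subseteq> klein_vertices m n"
      using twist(1,2) k l assms(1) by (auto simp: klein_vertices_def)
    ultimately show ?thesis unfolding is_C4_def klein_grid_def fst_conv snd_conv
      using d e1 e2 e3 e4 by blast
  qed
qed

end

theory Submission
  imports Defs
begin

text \<open>
  If \<open>n\<close> is odd, the sums \<open>x\<^sub>i\<^sub>,\<^sub>j + x\<^sub>i\<^sub>+\<^sub>1\<^sub>,\<^sub>j\<close> of vertical neighbours alternate around an odd cycle,
  so they all equal \<open>S/2\<close>. Following column 1 for two steps from row 1 (through the twist if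
  \<open>m = 2\<close>) then produces a second vertex with the label of \<open>(1,1)\<close>.

  If \<open>n\<close> is even, put \<open>x\<^sub>i\<^sub>,\<^sub>j = (mn+1)/2 \<plusminus> (1/2 + A\<^sub>i + B\<^sub>j)\<close> with the sign of \<open>(-1)\<^sup>i\<^sup>+\<^sup>j\<close>. The faces inside
  the grid are magic for any \<open>A\<close> and \<open>B\<close>. Those across the twist are magic if \<open>B\<close> is invariant under
  \<open>j \<mapsto> n+1-j\<close> (\<open>m\<close> odd), or if \<open>B\<^sub>j + B\<^sub>n\<^sub>+\<^sub>1\<^sub>-\<^sub>j\<close> is constant (\<open>m\<close> even). It remains to choose \<open>A\<close> and \<open>B\<close>
  so that \<open>A\<^sub>i + B\<^sub>j\<close> takes each value in \<open>{0..<mn/2}\<close> once with each sign.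
\<close>

lemma sum_4:
  assumes "distinct [a, b, c, d]"
  shows "(\<Sum>v\<in>{a, b, c, d}. f v) = f a + f b + f c + (f d :: nat)"
  using assms by (simp add: add.assoc)

lemma col_Suc_neq:
  assumes "n \<ge> 2" "1 \<le> j" "j \<le> n"
  shows "col n (j + 1) \<noteq> j"
  using assms by (auto simp: col_Suc)

text \<open>The reflection \<open>j\<close> -> \<open>n + 1 - j\<close> reverses the cyclic order of
  the columns, so it sends the successor of \<open>j\<close> to the predecessor of its image; at
  \<open>j = n\<close> both sides wrap around to \<open>n\<close>.\<close>

lemma col_reflect:
  assumes "1 \<le> j" "j \<le> n"
  shows "col n (n - j) = n + 1 - col n (j + 1)"
  using assms by (cases "j = n") (auto simp: col_Suc col_0 col_id)

lemma inner_face_sum: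
  fixes i :: nat
  assumes "n \<ge> 2" "1 \<le> j" "j \<le> n" and "k = col n (j + 1)"
  shows "(\<Sum>v\<in>{(i, j), (i, k), (i + 1, j), (i + 1, k)}. f v)
    = f (i, j) + f (i, k) + f (i + 1, j) + (f (i + 1, k) :: nat)"
  using col_Suc_neq[OF assms(1-3)] assms(4) by (intro sum_4) auto

lemma twist_face_sum:
  fixes m :: nat
  assumes "m \<ge> 2" "n \<ge> 2" "1 \<le> j" "j \<le> n" and "k = col n (j + 1)"
  shows "(\<Sum>v\<in>{(m, j), (m, k), (1, col n (n + 1 - j)), (1, col n (n - j))}. f v)
    = f (m, j) + f (m, k) + f (1, n + 1 - j) + (f (1, n + 1 - k) :: nat)"
proof -
  have "k \<le> n" "k \<noteq> j"
    using col_range[of n "j + 1"] col_Suc_neq[of n j] assms by auto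
  moreover have "col n (n + 1 - j) = n + 1 - j" using assms by (intro col_id) auto
  ultimately show ?thesis
    using assms col_reflect[of j n] by (subst sum_4) auto
qed

text \<open>Set sums become four-term equations because the vertices of a face are distinct. By
  \<open>col_reflect\<close> a twisted face consists of the twist edges at two consecutive columns,
  just as an inner face consists of two vertical edges.\<close>

lemma klein_labeling_iff:
  assumes "m \<ge> 2" "n \<ge> 2"
  shows "C4_face_magic_klein_labeling m n f \<longleftrightarrow>
    bij_betw f ({1..m} \<times> {1..n}) {1..m * n} \<and>
    (\<exists>S. (\<forall>i\<in>{1..<m}. \<forall>j\<in>{1..n}.
            f (i, j) + f (i, col n (j + 1)) + f (i + 1, j) + f (i + 1, col n (j + 1)) = S) \<and>
         (\<forall>j\<in>{1..n}. f (m, j) + f (m, col n (j + 1)) + f (1, n + 1 - j)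
            + f (1, n + 1 - col n (j + 1)) = S))"
proof -
  define G where
    "G i j = {(i, j), (i, col n (j + 1)), (i + 1, j), (i + 1, col n (j + 1))}" for i j :: nat
  define T where
    "T j = {(m, j), (m, col n (j + 1)), (1, col n (n + 1 - j)), (1, col n (n - j))}" for j
  have "{1..<m} = {i. 1 \<le> i \<and> i \<le> m - 1}"
    using assms by auto
  then have "klein_C4_faces m n = (\<Union>i\<in>{1..<m}. G i ` {1..n}) \<union> T ` {1..n}"
    unfolding klein_C4_faces_def G_def[symmetric] T_def[symmetric] by fastforce
  then have faces: "(\<forall>F \<in> klein_C4_faces m n. sum f F = S) \<longleftrightarrow>
      (\<forall>i\<in>{1..<m}. \<forall>j\<in>{1..n}. sum f (G i j) = S) \<and> (\<forall>j\<in>{1..n}. sum f (T j) = S)" for S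
    by (simp only: ball_Un ball_UN ball_simps)
  have G: "sum f (G i j)
      = f (i, j) + f (i, col n (j + 1)) + f (i + 1, j) + f (i + 1, col n (j + 1))"
    if "j \<in> {1..n}" for i j
    using that assms unfolding G_def by (intro inner_face_sum) auto
  have T: "sum f (T j)
      = f (m, j) + f (m, col n (j + 1)) + f (1, n + 1 - j) + f (1, n + 1 - col n (j + 1))"
    if "j \<in> {1..n}" for j
    using that assms unfolding T_def by (intro twist_face_sum) auto
  show ?thesis
    unfolding C4_face_magic_klein_labeling_def klein_grid_def klein_vertices_def fst_conv faces
    by (simp only: G T cong: ball_cong)
qed

text \<open>Along the cycle the values alternate between \<open>c 1\<close> and
  \<open>S - c 1\<close>. An odd cycle closes up with \<open>c n = c 1\<close>, which forces the two
  to agree.\<close>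

lemma odd_cycle_constant_sums:
  fixes c :: "nat \<Rightarrow> nat"
  assumes "odd n" and sums: "\<And>j. j \<in> {1..n} \<Longrightarrow> c j + c (col n (j + 1)) = S"
    and "j \<in> {1..n}"
  shows "2 * c j = S"
proof -
  have step: "c j + c (Suc j) = S" if "1 \<le> j" "j < n" for j
    using sums[of j] that by (simp add: col_Suc)
  have alt: "if odd j then c j = c 1 else c j + c 1 = S" if "1 \<le> j" "j \<le> n" for j
    using that
  proof (induction j rule: nat_induct_at_least)
    case (Suc j)
    then show ?case using step[of j] by (auto split: if_splits)
  qed simp
  have "n \<ge> 1" using \<open>odd n\<close> by (cases n) auto
  then have "c n + c 1 = S" using sums[of n] by (simp add: col_Suc)
  with alt[of n] \<open>odd n\<close> \<open>n \<ge> 1\<close> have "2 * c 1 = S" by simp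
  with alt[of j] assms(3) show ?thesis by (auto split: if_splits)
qed

lemma klein_labeling_imp_even:
  assumes "m \<ge> 2" "n \<ge> 2" and "C4_face_magic_klein_labeling m n f"
  shows "even n"
proof (rule ccontr)
  assume "odd n"
  from assms(3)[unfolded klein_labeling_iff[OF assms(1,2)]] obtain S where
    inj: "inj_on f ({1..m} \<times> {1..n})" and
    inner: "\<And>i j. i \<in> {1..<m} \<Longrightarrow> j \<in> {1..n} \<Longrightarrow>
      f (i, j) + f (i, col n (j + 1)) + f (i + 1, j) + f (i + 1, col n (j + 1)) = S" and
    twist: "\<And>j. j \<in> {1..n} \<Longrightarrow> f (m, j) + f (m, col n (j + 1)) + f (1, n + 1 - j)
            + f (1, n + 1 - col n (j + 1)) = S"
    by (auto simp: bij_betw_def)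
  have vert: "2 * (f (i, 1) + f (i + 1, 1)) = S" if "i \<in> {1..<m}" for i
    using odd_cycle_constant_sums[OF \<open>odd n\<close>, of "\<lambda>j. f (i, j) + f (i + 1, j)" S 1]
      inner[OF that] assms(2) by (simp add: algebra_simps)
  have vert_twist: "2 * (f (m, 1) + f (1, n)) = S"
    using odd_cycle_constant_sums[OF \<open>odd n\<close>, of "\<lambda>j. f (m, j) + f (1, n + 1 - j)" S 1]
      twist assms(2) by (simp add: algebra_simps)
  show False
  proof (cases "m = 2")
    case True
    \<comment> \<open>Both (1,1) and (1,n) are neighbours of (2,1), the latter through the
      twist.\<close>
    then have "f (1, 1) = f (1, n)" using vert[of 1] vert_twist by (simp add: numeral_2_eq_2)
    then show False using inj_onD[OF inj, of "(1, 1)" "(1, n)"] assms(1,2) by auto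
  next
    case False
    then have "f (1, 1) = f (3, 1)"
      using vert[of 1] vert[of 2] assms(1) by (simp add: numeral_2_eq_2 numeral_3_eq_3)
    then show False using inj_onD[OF inj, of "(1, 1)" "(3, 1)"] assms(1,2) False by auto
  qed
qed

text \<open>The halves are absorbed: with \<open>h = m * n div 2\<close> and offset
  \<open>a = A i + B j\<close>, the two signs give \<open>h + 1 + a\<close> and
  \<open>h - a\<close>. The subtraction is exact once \<open>a < h\<close>.\<close>

definition alternating_label :: "nat \<Rightarrow> nat \<Rightarrow> (nat \<Rightarrow> nat) \<Rightarrow> (nat \<Rightarrow> nat) \<Rightarrow> nat \<times> nat \<Rightarrow> nat" where
  "alternating_label m n A B = (\<lambda>(i, j).
     if even (i + j) then m * n div 2 + 1 + (A i + B j) else m * n div 2 - (A i + B j))"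

text \<open>A label exceeds \<open>m * n div 2\<close> exactly on cells with \<open>i + j\<close>
  even, so it determines the parity, then the offset, then the cell. Surjectivity follows by
  counting.\<close>

lemma alternating_label_bij:
  assumes "even n"
    and bound: "\<And>i j. i \<in> {1..m} \<Longrightarrow> j \<in> {1..n} \<Longrightarrow> A i + B j < m * n div 2"
    and unique: "\<And>i j i' j'. \<lbrakk>i \<in> {1..m}; j \<in> {1..n}; i' \<in> {1..m}; j' \<in> {1..n};
      even (i + j) = even (i' + j'); A i + B j = A i' + B j'\<rbrakk> \<Longrightarrow> i = i' \<and> j = j'"
  shows "bij_betw (alternating_label m n A B) ({1..m} \<times> {1..n}) {1..m * n}"
proof -
  let ?V = "{1..m} \<times> {1..n}" and ?f = "alternating_label m n A B"
  define h where "h = m * n div 2"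
  have h: "m * n = 2 * h" using \<open>even n\<close> by (auto simp: h_def)
  have f: "?f (i, j) = (if even (i + j) then h + 1 + (A i + B j) else h - (A i + B j))" for i j
    by (simp add: alternating_label_def h_def)
  have inj: "inj_on ?f ?V"
  proof (rule inj_onI, clarify)
    fix i j i' j'
    assume ij: "i \<in> {1..m}" "j \<in> {1..n}" "i' \<in> {1..m}" "j' \<in> {1..n}"
      and eq: "?f (i, j) = ?f (i', j')"
    have "A i + B j < h" "A i' + B j' < h" using bound ij by (auto simp: h_def)
    then have "even (i + j) = even (i' + j') \<and> A i + B j = A i' + B j'"
      using eq unfolding f by (auto split: if_splits)
    then show "i = i' \<and> j = j'" using unique ij by blast
  qed
  have "?f (i, j) \<in> {1..2 * h}" if "i \<in> {1..m}" "j \<in> {1..n}" for i j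
    using bound[OF that] unfolding f h_def[symmetric] by auto
  then have "?f ` ?V \<subseteq> {1..m * n}" unfolding h by blast
  moreover have "card (?f ` ?V) = card {1..m * n}"
    using card_image[OF inj] by (simp add: card_cartesian_product)
  ultimately have "?f ` ?V = {1..m * n}" by (intro card_subset_eq) auto
  with inj show ?thesis by (simp add: bij_betw_def)
qed

text \<open>Horizontal neighbours have opposite signs, so \<open>A\<close> cancels in every face. As
  \<open>n\<close> is even, \<open>j\<close> and \<open>n + 1 - j\<close> differ in parity; hence
  the ends of a twist edge have opposite signs for odd \<open>m\<close> and equal signs for even
  \<open>m\<close>, and the two conditions on \<open>B\<close> are what cancels in each
  case.\<close>

lemma alternating_label_magic:
  assumes "m \<ge> 2" "n \<ge> 2" "even n"
    and bound: "\<And>i j. i \<in> {1..m} \<Longrightarrow> j \<in> {1..n} \<Longrightarrow> A i + B j < m * n div 2"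
    and unique: "\<And>i j i' j'. \<lbrakk>i \<in> {1..m}; j \<in> {1..n}; i' \<in> {1..m}; j' \<in> {1..n};
      even (i + j) = even (i' + j'); A i + B j = A i' + B j'\<rbrakk> \<Longrightarrow> i = i' \<and> j = j'"
    and refl_odd: "\<And>j. odd m \<Longrightarrow> j \<in> {1..n} \<Longrightarrow> B (n + 1 - j) = B j"
    and refl_even: "\<And>j. even m \<Longrightarrow> j \<in> {1..n} \<Longrightarrow> B (n + 1 - j) + B j = C"
  shows "C4_face_magic_klein_labeling m n (alternating_label m n A B)"
proof -
  let ?f = "alternating_label m n A B"
  define h where "h = m * n div 2"
  have f: "int (?f (i, j)) = (if even (i + j) then int h + 1 + (int (A i) + int (B j))
      else int h - (int (A i) + int (B j)))" if "i \<in> {1..m}" "j \<in> {1..n}" for i j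
    using bound[OF that] by (simp add: alternating_label_def h_def of_nat_diff)
  have next_col: "col n (j + 1) \<in> {1..n}" "even (col n (j + 1)) \<longleftrightarrow> odd j" if "j \<in> {1..n}" for j
    using that \<open>even n\<close> col_range[of n "j + 1"] by (auto simp: col_Suc)
  have refl: "n + 1 - j \<in> {1..n}" "even (n + 1 - j) \<longleftrightarrow> odd j" if "j \<in> {1..n}" for j
    using that \<open>even n\<close> by auto
  have inner: "?f (i, j) + ?f (i, col n (j + 1)) + ?f (i + 1, j) + ?f (i + 1, col n (j + 1))
      = 4 * h + 2" if i: "i \<in> {1..<m}" and j: "j \<in> {1..n}" for i j
  proof -
    define k where "k = col n (j + 1)"
    have k: "k \<in> {1..n}" "even k \<longleftrightarrow> odd j" using next_col[OF j] by (auto simp: k_def)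
    have i': "i \<in> {1..m}" "i + 1 \<in> {1..m}" using i by auto
    have "int (?f (i, j)) + int (?f (i, k)) + int (?f (i + 1, j)) + int (?f (i + 1, k))
        = 4 * int h + 2"
      using k(2) unfolding f[OF i'(1) j] f[OF i'(1) k(1)] f[OF i'(2) j] f[OF i'(2) k(1)] by auto
    then show ?thesis unfolding k_def by linarith
  qed
  have twist: "?f (m, j) + ?f (m, col n (j + 1)) + ?f (1, n + 1 - j)
      + ?f (1, n + 1 - col n (j + 1)) = 4 * h + 2" if j: "j \<in> {1..n}" for j
  proof -
    define k where "k = col n (j + 1)"
    define j' where "j' = n + 1 - j"
    define k' where "k' = n + 1 - k"
    have k: "k \<in> {1..n}" "even k \<longleftrightarrow> odd j" using next_col[OF j] by (auto simp: k_def)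
    have j': "j' \<in> {1..n}" "even j' \<longleftrightarrow> odd j" using refl[OF j] by (auto simp: j'_def)
    have k': "k' \<in> {1..n}" "even k' \<longleftrightarrow> odd k" using refl[OF k(1)] by (auto simp: k'_def)
    have B: "if odd m then B j' = B j \<and> B k' = B k
        else int (B j') + int (B j) = int (B k') + int (B k)"
      using refl_odd[OF _ j] refl_odd[OF _ k(1)] refl_even[OF _ j] refl_even[OF _ k(1)]
      unfolding j'_def k'_def by (auto simp flip: of_nat_add)
    have m: "m \<in> {1..m}" "1 \<in> {1..m}" using \<open>m \<ge> 2\<close> by auto
    have "int (?f (m, j)) + int (?f (m, k)) + int (?f (1, j')) + int (?f (1, k'))
        = 4 * int h + 2"
      using k(2) j'(2) k'(2) B
      unfolding f[OF m(1) j] f[OF m(1) k(1)] f[OF m(2) j'(1)] f[OF m(2) k'(1)] by (auto split: if_splits)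
    then show ?thesis unfolding k'_def j'_def k_def by linarith
  qed
  have "bij_betw ?f ({1..m} \<times> {1..n}) {1..m * n}"
    by (rule alternating_label_bij[OF \<open>even n\<close>]) (fact bound, fact unique)
  with inner twist show ?thesis unfolding klein_labeling_iff[OF assms(1,2)] by blast
qed

lemma mult_add_eq_iff:
  fixes k :: nat
  assumes "b < k" "b' < k"
  shows "k * a + b = k * a' + b' \<longleftrightarrow> a = a' \<and> b = b'"
proof
  assume eq: "k * a + b = k * a' + b'"
  have "a = (k * a + b) div k" "a' = (k * a' + b') div k" using assms by auto
  then show "a = a' \<and> b = b'" using eq by simp
qed simp

lemma mult_add_less:
  fixes k :: nat
  assumes "a < c" "b < k"
  shows "k * a + b < c * k"
proof -
  have "k * a + b < k * (a + 1)" using assms by simp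
  also have "\<dots> \<le> k * c" using assms by (intro mult_le_mono) auto
  finally show ?thesis by (simp add: mult.commute)
qed

text \<open>Each row carries its own block of \<open>k\<close> offsets. Inside it every value of
  \<open>B\<close> occurs at two mirror columns, which have opposite parity and hence opposite
  signs.\<close>

lemma klein_labeling_odd_rows:
  assumes "m \<ge> 2" "n \<ge> 2" "even n" "odd m"
  shows "\<exists>f. C4_face_magic_klein_labeling m n f"
proof -
  define k where "k = n div 2"
  have n: "n = 2 * k" using \<open>even n\<close> by (simp add: k_def)
  define B where "B j = min j (n + 1 - j) - 1" for j
  have B_less: "B j < k" if "j \<in> {1..n}" for j using that by (auto simp: B_def n)
  have "C4_face_magic_klein_labeling m n (alternating_label m n (\<lambda>i. k * (i - 1)) B)"
  proof (rule alternating_label_magic)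
    fix i j assume "i \<in> {1..m}" "j \<in> {1..n}"
    then have "i - 1 < m" "B j < k" using B_less by auto
    then have "k * (i - 1) + B j < m * k" by (rule mult_add_less)
    then show "k * (i - 1) + B j < m * n div 2" by (simp add: n)
  next
    fix i j i' j'
    assume *: "i \<in> {1..m}" "j \<in> {1..n}" "i' \<in> {1..m}" "j' \<in> {1..n}"
      "even (i + j) = even (i' + j')" "k * (i - 1) + B j = k * (i' - 1) + B j'"
    then have "i - 1 = i' - 1" and B: "B j = B j'" using mult_add_eq_iff B_less by auto
    then have i: "i = i'" using * by auto
    from B have "j = j' \<or> j = n + 1 - j'" using *(2,4) by (auto simp: B_def min_def split: if_splits)
    then show "i = i' \<and> j = j'" using i * \<open>even n\<close> by auto
  next
    fix j assume "j \<in> {1..n}"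
    then show "B (n + 1 - j) = B j" by (auto simp: B_def min_def)
  qed (use assms in auto)
  then show ?thesis by blast
qed

text \<open>Here two consecutive rows share a block of \<open>n\<close> offsets: \<open>B\<close>
  runs once through {0..<n} in each row, and the two rows have opposite signs in every
  column.\<close>

lemma klein_labeling_even_rows:
  assumes "m \<ge> 2" "n \<ge> 2" "even n" "even m"
  shows "\<exists>f. C4_face_magic_klein_labeling m n f"
proof -
  define k where "k = n div 2"
  have n: "n = 2 * k" using \<open>even n\<close> by (simp add: k_def)
  \<comment> \<open>This is \<open>j - 1\<close> shifted cyclically by half a period, which keeps
    mirror columns summing to \<open>n - 1\<close>.\<close>
  define B where "B j = (if j \<le> k then k + j - 1 else j - k - 1)" for j
  have B_less: "B j < n" if "j \<in> {1..n}" for j using that by (auto simp: B_def n)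
  have "C4_face_magic_klein_labeling m n (alternating_label m n (\<lambda>i. n * ((i - 1) div 2)) B)"
  proof (rule alternating_label_magic)
    fix i j assume "i \<in> {1..m}" "j \<in> {1..n}"
    moreover from this have "(i - 1) div 2 < m div 2" using \<open>even m\<close> by auto
    moreover have "m div 2 * n = m * n div 2" using \<open>even m\<close> by (simp add: div_mult_swap mult.commute)
    ultimately show "n * ((i - 1) div 2) + B j < m * n div 2"
      using mult_add_less[of "(i - 1) div 2" "m div 2" "B j" n] B_less by simp
  next
    fix i j i' j'
    assume *: "i \<in> {1..m}" "j \<in> {1..n}" "i' \<in> {1..m}" "j' \<in> {1..n}"
      "even (i + j) = even (i' + j')"
      "n * ((i - 1) div 2) + B j = n * ((i' - 1) div 2) + B j'"
    then have i: "(i - 1) div 2 = (i' - 1) div 2" and B: "B j = B j'"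
      using mult_add_eq_iff B_less by auto
    from B have j: "j = j'" using *(2,4) by (auto simp: B_def n split: if_splits)
    with *(5) have "even i = even i'" by (simp, argo)
    \<comment> \<open>The rows sharing a value of \<open>(i - 1) div 2\<close> are one odd row and
      the even row after it, so parity separates them.\<close>
    with i *(1,3) have "i = i'" unfolding atLeastAtMost_iff by presburger
    with j show "i = i' \<and> j = j'" by simp
  next
    fix j assume "j \<in> {1..n}"
    then show "B (n + 1 - j) + B j = n - 1" by (auto simp: B_def n)
  qed (use assms in auto)
  then show ?thesis by blast
qed

theorem theorem3p7:
  fixes m n :: nat
  assumes "m \<ge> 2" and "n \<ge> 2"
  shows "(\<exists>f. C4_face_magic_klein_labeling m n f) \<longleftrightarrow> even n"
  using klein_labeling_imp_even klein_labeling_odd_rows klein_labeling_even_rows assms by blast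

end
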